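(* Let $V$ be a Komori variety and let $A$ be an MV-algebra in $V$. Then $A$ is a model of $\mathbb{L}oc_V^1$ if and only if it is a local MV-algebra.
   Context: An MV-algebra is a structure $(A,\oplus,\neg,0)$ such that $(A,\oplus,0)$ is a commutative monoid, $\neg\neg x=x$, $x\oplus\neg 0=\neg 0$ and $\neg(\neg x\oplus y)\oplus y=\neg(\neg y\oplus x)\oplus x$. Write $1=\neg 0$, $x\odot y=\neg(\neg x\oplus\neg y)$, $kx=x\oplus\cdots\oplus x$ and $x^k=x\odot\cdots\odot x$ ($k$ times). An MV-algebra is local if it is non-trivial and for every $x$ there is $k\ge 1$ with $kx=1$ or $k(\neg x)=1$ (i.e. it is a model of the geometric theory $\mathbb{L}oc$). For a lattice-ordered abelian group $G$ and $u\ge 0$ in $G$, $\Gamma(G,u)$ is the MV-algebra on $[0,u]$ with $x\oplus y=\inf(x+y,u)$, $\neg x=u-x$. For $m\ge 1$, $S_m=\Gamma(\mathbb{Z},m)$ and $S_m^\omega=\Gamma(\mathbb{Z}\times_{\mathrm{lex}}\mathbb{Z},(m,0))$. A Komori variety is a variety $V=V(\{S_i\}_{i\in I},\{S_j^\omega\}_{j\in J})$ generated by these algebras, with $I,J$ finite sets of positive integers, not both empty. Put $n=\mathrm{l.c.m.}(I\cup J)$, which depends only on $V$. $\mathbb{T}_V$ denotes the algebraic theory axiomatizing $V$ (so its set-based models are exactly the algebras in $V$). $\mathbb{L}oc_V^1$ is obtained from $\mathbb{T}_V$ by adding the sequents $\sigma_n:(\top\vdash_x((n+1)x)^2=0\vee(n+1)x=1)$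 and $(0=1\vdash\bot)$. The axiom of choice is assumed. *)

theory Defs
  imports "HOL-Library.Lattice_Algebras" "HOL-Library.Product_Plus" "HOL-Library.Product_Lexorder"
begin

section \<open>MV-algebras\<close>

record 'a mv =
  carrier :: "'a set"
  oplus :: "'a \<Rightarrow> 'a \<Rightarrow> 'a" (infixl "\<oplus>\<index>" 65)
  neg :: "'a \<Rightarrow> 'a" ("\<sim>\<index> _" [81] 80)
  zero :: 'a ("\<zero>\<index>")

locale mv_signature =
  fixes A :: "'a mv" (structure)
  assumes oplus_closed: "x \<in> carrier A \<Longrightarrow> y \<in> carrier A \<Longrightarrow> x \<oplus> y \<in> carrier A"
    and neg_closed: "x \<in> carrier A \<Longrightarrow> \<sim> x \<in> carrier A"
    and zero_closed: "\<zero> \<in> carrier A"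

locale mv_algebra = mv_signature +
  assumes oplus_assoc:
      "\<lbrakk>x \<in> carrier A; y \<in> carrier A; z \<in> carrier A\<rbrakk> \<Longrightarrow> (x \<oplus> y) \<oplus> z = x \<oplus> (y \<oplus> z)"
    and oplus_comm: "\<lbrakk>x \<in> carrier A; y \<in> carrier A\<rbrakk> \<Longrightarrow> x \<oplus> y = y \<oplus> x"
    and oplus_zero: "x \<in> carrier A \<Longrightarrow> x \<oplus> \<zero> = x"
    and neg_neg: "x \<in> carrier A \<Longrightarrow> \<sim> (\<sim> x) = x"
    and oplus_neg_zero: "x \<in> carrier A \<Longrightarrow> x \<oplus> \<sim> \<zero> = \<sim> \<zero>"
    and mv_axiom: "\<lbrakk>x \<in> carrier A; y \<in> carrier A\<rbrakk> \<Longrightarrow>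
      \<sim> (\<sim> x \<oplus> y) \<oplus> y = \<sim> (\<sim> y \<oplus> x) \<oplus> x"

definition one :: "'a mv \<Rightarrow> 'a" ("\<one>\<index>") where
  "\<one>\<^bsub>A\<^esub> = \<sim>\<^bsub>A\<^esub> \<zero>\<^bsub>A\<^esub>"

definition odot :: "'a mv \<Rightarrow> 'a \<Rightarrow> 'a \<Rightarrow> 'a" (infixl "\<odot>\<index>" 70) where
  "x \<odot>\<^bsub>A\<^esub> y = \<sim>\<^bsub>A\<^esub> (\<sim>\<^bsub>A\<^esub> x \<oplus>\<^bsub>A\<^esub> \<sim>\<^bsub>A\<^esub> y)"

primrec mult :: "'a mv \<Rightarrow> nat \<Rightarrow> 'a \<Rightarrow> 'a" where
  "mult A 0 x = \<zero>\<^bsub>A\<^esub>"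
| "mult A (Suc k) x = x \<oplus>\<^bsub>A\<^esub> mult A k x"

primrec pow :: "'a mv \<Rightarrow> 'a \<Rightarrow> nat \<Rightarrow> 'a" where
  "pow A x 0 = \<one>\<^bsub>A\<^esub>"
| "pow A x (Suc k) = x \<odot>\<^bsub>A\<^esub> pow A x k"

definition local_mv_algebra :: "'a mv \<Rightarrow> bool" where
  "local_mv_algebra A \<longleftrightarrow> mv_algebra A \<and> carrier A \<noteq> {\<zero>\<^bsub>A\<^esub>} \<and>
     (\<forall>x\<in>carrier A. \<exists>k\<ge>1. mult A k x = \<one>\<^bsub>A\<^esub> \<or> mult A k (\<sim>\<^bsub>A\<^esub> x) = \<one>\<^bsub>A\<^esub>)"

section \<open>The algebras \<open>\<Gamma>(G,u)\<close>\<close>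

definition Gamma :: "'g::lattice_ab_group_add \<Rightarrow> 'g mv" where
  "Gamma u = \<lparr>carrier = {0..u}, oplus = (\<lambda>x y. inf (x + y) u), neg = (\<lambda>x. u - x), zero = 0\<rparr>"

lemma mv_algebra_Gamma:
  fixes u :: "'g::lattice_ab_group_add"
  assumes "0 \<le> u"
  shows "mv_algebra (Gamma u)"
proof -
  have join: "inf (u - inf (u - x + y) u + y) u = sup x y" if "x \<le> u" "y \<le> u" for x y :: 'g
  proof -
    have "u - inf (u - x + y) u = sup (u - (u - x + y)) (u - u)"
      by (simp only: diff_conv_add_uminus neg_inf_eq_sup add_sup_distrib_left)
    also have "\<dots> = sup (x - y) 0"
      by (simp add: diff_diff_eq2)
    finally have "u - inf (u - x + y) u + y = sup x y"
      by (simp add: add_sup_distrib_right)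
    moreover have "sup x y \<le> u" using that by simp
    ultimately show ?thesis by (simp add: inf_absorb1)
  qed
  have assoc: "inf (inf (x + y) u + z) u = inf (x + y + z) u" if "0 \<le> z" for x y z :: 'g
  proof -
    have "u \<le> u + z" using that by simp
    then show ?thesis by (simp add: add_inf_distrib_right inf_assoc inf_absorb2)
  qed
  have assoc': "inf (x + inf (y + z) u) u = inf (x + y + z) u" if "0 \<le> x" for x y z :: 'g
  proof -
    have "x + inf (y + z) u = inf (y + z) u + x" "x + y + z = y + z + x"
      by (simp_all only: ac_simps)
    with assoc[OF that, of y z] show ?thesis by (simp only:)
  qed
  show ?thesis
  proof
    fix x y z assume "x \<in> carrier (Gamma u)" "y \<in> carrier (Gamma u)" "z \<in> carrier (Gamma u)"
    then show "x \<oplus>\<^bsub>Gamma u\<^esub> y \<oplus>\<^bsub>Gamma u\<^esub> z = x \<oplus>\<^bsub>Gamma u\<^esub> (y \<oplus>\<^bsub>Gamma u\<^esub> z)"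
      by (simp add: Gamma_def assoc assoc')
  next
    fix x y assume "x \<in> carrier (Gamma u)" "y \<in> carrier (Gamma u)"
    then show "\<sim>\<^bsub>Gamma u\<^esub> (\<sim>\<^bsub>Gamma u\<^esub> x \<oplus>\<^bsub>Gamma u\<^esub> y) \<oplus>\<^bsub>Gamma u\<^esub> y
        = \<sim>\<^bsub>Gamma u\<^esub> (\<sim>\<^bsub>Gamma u\<^esub> y \<oplus>\<^bsub>Gamma u\<^esub> x) \<oplus>\<^bsub>Gamma u\<^esub> x"
      by (simp add: Gamma_def join sup_commute del: diff_inf_eq_sup)
  next
    fix x y assume "x \<in> carrier (Gamma u)" "y \<in> carrier (Gamma u)"
    then show "x \<oplus>\<^bsub>Gamma u\<^esub> y = y \<oplus>\<^bsub>Gamma u\<^esub> x"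
      by (simp only: Gamma_def mv.simps add.commute)
  next
    fix x assume "x \<in> carrier (Gamma u)"
    then have "x \<le> u" "u \<le> x + u" by (simp_all add: Gamma_def)
    then show "x \<oplus>\<^bsub>Gamma u\<^esub> \<zero>\<^bsub>Gamma u\<^esub> = x"
      and "x \<oplus>\<^bsub>Gamma u\<^esub> \<sim>\<^bsub>Gamma u\<^esub> \<zero>\<^bsub>Gamma u\<^esub> = \<sim>\<^bsub>Gamma u\<^esub> \<zero>\<^bsub>Gamma u\<^esub>"
      by (simp_all add: Gamma_def inf_absorb1[of x u] inf_absorb2[of u "x + u"])
  qed (use assms in \<open>simp_all add: Gamma_def\<close>)
qed

text \<open>The order on pairs is the lexicographic one.\<close>

instance prod :: (linordered_ab_group_add, linordered_ab_group_add) lattice_ab_group_add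
proof
  fix x y z :: "'a \<times> 'b"
  assume "x \<le> y"
  then have "fst x < fst y \<or> fst x \<le> fst y \<and> snd x \<le> snd y"
    by (simp only: less_eq_prod_def)
  then have "fst z + fst x < fst z + fst y \<or> fst z + fst x \<le> fst z + fst y \<and> snd z + snd x \<le> snd z + snd y"
    by (simp only: add_less_cancel_left add_le_cancel_left)
  then show "z + x \<le> z + y"
    by (simp only: less_eq_prod_def fst_add snd_add)
qed

definition S :: "nat \<Rightarrow> int mv" where
  "S m = Gamma (int m)"

definition S_omega :: "nat \<Rightarrow> (int \<times> int) mv" where
  "S_omega m = Gamma (int m, 0)"

section \<open>Varieties\<close>

datatype mv_term = Var nat | Zero | Neg mv_term | Oplus mv_term mv_term

type_synonym mv_equation = "mv_term \<times> mv_term"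

primrec interp :: "'a mv \<Rightarrow> (nat \<Rightarrow> 'a) \<Rightarrow> mv_term \<Rightarrow> 'a" where
  "interp A v (Var i) = v i"
| "interp A v Zero = \<zero>\<^bsub>A\<^esub>"
| "interp A v (Neg t) = \<sim>\<^bsub>A\<^esub> interp A v t"
| "interp A v (Oplus s t) = interp A v s \<oplus>\<^bsub>A\<^esub> interp A v t"

definition satisfies :: "'a mv \<Rightarrow> mv_equation \<Rightarrow> bool" where
  "satisfies A e \<longleftrightarrow> (\<forall>v. range v \<subseteq> carrier A \<longrightarrow> interp A v (fst e) = interp A v (snd e))"

definition models :: "mv_equation set \<Rightarrow> 'a mv \<Rightarrow> bool" where
  "models E A \<longleftrightarrow> mv_signature A \<and> (\<forall>e\<in>E. satisfies A e)"

text \<open>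
  A variety is a class of the form \<open>models E\<close>; the variety generated by the \<open>S i\<close> and
  \<open>S_omega j\<close> is the smallest one containing them.
\<close>

definition komori_variety :: "nat set \<Rightarrow> nat set \<Rightarrow> 'a mv \<Rightarrow> bool" where
  "komori_variety I J A \<longleftrightarrow>
     (\<forall>E. (\<forall>i\<in>I. models E (S i)) \<and> (\<forall>j\<in>J. models E (S_omega j)) \<longrightarrow> models E A)"

definition T_V :: "nat set \<Rightarrow> nat set \<Rightarrow> mv_equation set" where
  "T_V I J = {e. (\<forall>i\<in>I. satisfies (S i) e) \<and> (\<forall>j\<in>J. satisfies (S_omega j) e)}"

lemma mv_algebra_S: "mv_algebra (S m)"
  by (simp add: S_def mv_algebra_Gamma)

lemma mv_algebra_S_omega: "mv_algebra (S_omega m)"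
proof -
  have "(0 :: int \<times> int) \<le> (int m, 0)"
    by (simp add: less_eq_prod_def)
  then show ?thesis
    unfolding S_omega_def by (rule mv_algebra_Gamma)
qed

lemma models_T_V_iff: "models (T_V I J) A \<longleftrightarrow> komori_variety I J A"
proof
  assume A: "models (T_V I J) A"
  show "komori_variety I J A"
    unfolding komori_variety_def
  proof (intro allI impI)
    fix E
    assume "(\<forall>i\<in>I. models E (S i)) \<and> (\<forall>j\<in>J. models E (S_omega j))"
    then have "E \<subseteq> T_V I J"
      unfolding models_def T_V_def by blast
    with A show "models E A"
      unfolding models_def by blast
  qed
next
  assume A: "komori_variety I J A"
  have "models (T_V I J) (S i)" if "i \<in> I" for i
    using that mv_algebra.axioms(1)[OF mv_algebra_S] unfolding models_def T_V_def by blast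
  moreover have "models (T_V I J) (S_omega j)" if "j \<in> J" for j
    using that mv_algebra.axioms(1)[OF mv_algebra_S_omega] unfolding models_def T_V_def by blast
  ultimately show "models (T_V I J) A"
    using A unfolding komori_variety_def by blast
qed

text \<open>
  The set-based models of the theory \<open>Loc\<^sub>V\<^sup>1\<close>; the sequents are spelled out semantically.
\<close>

definition sigma :: "nat \<Rightarrow> 'a mv \<Rightarrow> bool" where
  "sigma n A \<longleftrightarrow>
     (\<forall>x\<in>carrier A. pow A (mult A (n + 1) x) 2 = \<zero>\<^bsub>A\<^esub> \<or> mult A (n + 1) x = \<one>\<^bsub>A\<^esub>)"

definition Loc_V1_model :: "nat set \<Rightarrow> nat set \<Rightarrow> 'a mv \<Rightarrow> bool" where
  "Loc_V1_model I J A \<longleftrightarrow>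
     models (T_V I J) A \<and> sigma (Lcm (I \<union> J)) A \<and> (\<zero>\<^bsub>A\<^esub> = \<one>\<^bsub>A\<^esub> \<longrightarrow> False)"

end

theory Submission
  imports Defs
begin

text \<open>
  Put \<open>n = Lcm (I \<union> J)\<close> and \<open>t(x) = ((n + 1) x)\<^sup>2\<close>. The point is that \<open>t(x)\<close> takes only the values
  \<open>0\<close> and \<open>1\<close> in every generator of the variety. An element of \<open>S m\<close> or \<open>S_omega m\<close> either has
  (leading) coordinate at least \<open>1\<close>, and then its \<open>(n + 1)\<close>-fold sum exceeds the unit because
  \<open>m \<le> n < n + 1\<close>, or it has (leading) coordinate \<open>0\<close>, and then twice its \<open>(n + 1)\<close>-fold sum still lies
  below the unit (\<open>Gamma_dichotomy\<close>). A disjunction need not be inherited by the other algebras of the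
  variety, but its equational consequences \<open>t \<oplus> t = t\<close> and \<open>\<sim> t \<oplus> \<sim> t = \<sim> t\<close> are.

  In a local algebra such an idempotent \<open>t(x)\<close> has to be \<open>0\<close> or \<open>1\<close>, as multiples of idempotents do
  not grow, and \<open>t(x) = 1\<close> forces \<open>(n + 1) x = 1\<close>; this gives \<open>\<sigma>\<^sub>n\<close>. Conversely, if \<open>((n + 1) x)\<^sup>2 = 0\<close>
  then \<open>2 (\<sim> ((n + 1) x)) = 1\<close>, and \<open>\<sim> ((n + 1) x) \<le> \<sim> x\<close> gives \<open>2 (\<sim> x) = 1\<close>, so \<open>\<sigma>\<^sub>n\<close> implies
  locality in every nontrivial MV-algebra.
\<close>

section \<open>Multiples, squares and idempotents in MV-algebras\<close>

context mv_algebra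
begin

lemma one_closed: "\<one> \<in> carrier A"
  by (simp add: one_def neg_closed zero_closed)

lemma neg_one: "\<sim> \<one> = \<zero>"
  by (simp add: one_def neg_neg zero_closed)

lemma oplus_one: "x \<in> carrier A \<Longrightarrow> x \<oplus> \<one> = \<one>"
  by (simp add: one_def oplus_neg_zero)

lemma zero_oplus: "x \<in> carrier A \<Longrightarrow> \<zero> \<oplus> x = x"
  using oplus_comm[of \<zero> x] by (simp add: oplus_zero zero_closed)

lemma mult_closed: "x \<in> carrier A \<Longrightarrow> mult A k x \<in> carrier A"
  by (induction k) (simp_all add: zero_closed oplus_closed)

lemma mult_two: "x \<in> carrier A \<Longrightarrow> mult A 2 x = x \<oplus> x"
  by (simp add: numeral_2_eq_2 oplus_zero)

lemma pow_two: "x \<in> carrier A \<Longrightarrow> pow A x 2 = \<sim> (\<sim> x \<oplus> \<sim> x)"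
  by (simp add: numeral_2_eq_2 odot_def neg_one oplus_zero neg_closed neg_neg)

lemma pow_closed: "x \<in> carrier A \<Longrightarrow> pow A x k \<in> carrier A"
  by (induction k) (simp_all add: one_closed odot_def oplus_closed neg_closed)

text \<open>The law \<open>mv_axiom\<close> at the pair \<open>x\<close>, \<open>1\<close>.\<close>

lemma neg_oplus_self:
  assumes x: "x \<in> carrier A"
  shows "\<sim> x \<oplus> x = \<one>"
proof -
  have "\<sim> (\<sim> x \<oplus> \<one>) \<oplus> \<one> = \<sim> (\<sim> \<one> \<oplus> x) \<oplus> x"
    using x by (intro mv_axiom one_closed)
  then show ?thesis
    using x by (simp add: neg_one zero_oplus oplus_one neg_closed one_closed zero_closed)
qed

text \<open>
  Negation reverses the natural order, where \<open>a \<le> b\<close> means that \<open>b = w \<oplus> a\<close> for some \<open>w\<close>. The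
  witness comes from writing the join of \<open>\<sim> x\<close> and \<open>\<sim> (x \<oplus> z)\<close> in the two ways equated by
  \<open>mv_axiom\<close>.
\<close>

lemma neg_eq_oplus_neg:
  assumes x: "x \<in> carrier A" and z: "z \<in> carrier A"
  obtains w where "w \<in> carrier A" and "\<sim> x = w \<oplus> \<sim> (x \<oplus> z)"
proof
  let ?y = "x \<oplus> z"
  have y: "?y \<in> carrier A" using x z by (rule oplus_closed)
  show "\<sim> (x \<oplus> \<sim> ?y) \<in> carrier A"
    using x y by (simp add: neg_closed oplus_closed)
  have "?y \<oplus> \<sim> x = z \<oplus> (x \<oplus> \<sim> x)"
    using x z by (simp add: oplus_comm[of x z] oplus_assoc neg_closed)
  also have "x \<oplus> \<sim> x = \<sim> x \<oplus> x"
    using x by (intro oplus_comm neg_closed)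
  finally have "?y \<oplus> \<sim> x = \<one>"
    using x z by (simp add: neg_oplus_self oplus_one)
  moreover have "\<sim> (\<sim> (\<sim> x) \<oplus> \<sim> ?y) \<oplus> \<sim> ?y = \<sim> (\<sim> (\<sim> ?y) \<oplus> \<sim> x) \<oplus> \<sim> x"
    using x y by (intro mv_axiom neg_closed)
  ultimately show "\<sim> x = \<sim> (x \<oplus> \<sim> ?y) \<oplus> \<sim> ?y"
    using x y by (simp add: neg_neg neg_one zero_oplus neg_closed)
qed

lemma mult_two_neg_eq_one:
  assumes x: "x \<in> carrier A" and sq: "pow A (mult A (Suc n) x) 2 = \<zero>"
  shows "mult A 2 (\<sim> x) = \<one>"
proof -
  define y where "y = x \<oplus> mult A n x"
  have y: "y \<in> carrier A"
    using x by (simp add: y_def oplus_closed mult_closed)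
  obtain w where w: "w \<in> carrier A" "\<sim> x = w \<oplus> \<sim> y"
    unfolding y_def by (rule neg_eq_oplus_neg[OF x mult_closed[OF x]])
  have "\<sim> (\<sim> y \<oplus> \<sim> y) = \<zero>"
    using sq pow_two[OF y] by (simp add: y_def)
  then have one: "\<sim> y \<oplus> \<sim> y = \<one>"
    using y neg_neg[of "\<sim> y \<oplus> \<sim> y"] by (simp add: one_def neg_closed oplus_closed)
  have "\<sim> x \<oplus> \<sim> x = w \<oplus> (\<sim> y \<oplus> (w \<oplus> \<sim> y))"
    unfolding w(2) using w(1) y by (simp add: oplus_assoc oplus_closed neg_closed)
  also have "\<sim> y \<oplus> (w \<oplus> \<sim> y) = (w \<oplus> \<sim> y) \<oplus> \<sim> y"
    using w(1) y by (intro oplus_comm oplus_closed neg_closed)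
  also have "\<dots> = w \<oplus> (\<sim> y \<oplus> \<sim> y)"
    using w(1) y by (intro oplus_assoc neg_closed)
  finally show ?thesis
    using x w(1) by (simp add: one oplus_one mult_two neg_closed)
qed

lemma mult_idempotent:
  assumes b: "b \<in> carrier A" "b \<oplus> b = b" and "1 \<le> k"
  shows "mult A k b = b"
  using \<open>1 \<le> k\<close> by (induction k rule: dec_induct) (simp_all add: b oplus_zero)

text \<open>
  Some multiple of \<open>b\<close> or of \<open>\<sim> b\<close> reaches \<open>1\<close>, but multiples of idempotents do not grow. In terms of
  structure: idempotents are the complemented elements and split an algebra into a direct product,
  while local algebras are indecomposable.
\<close>

lemma local_idempotent_cases:
  assumes local: "local_mv_algebra A" and b: "b \<in> carrier A"
    and "b \<oplus> b = b" and "\<sim> b \<oplus> \<sim> b = \<sim> b"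
  shows "b = \<zero> \<or> b = \<one>"
proof -
  obtain k where "1 \<le> k" and "mult A k b = \<one> \<or> mult A k (\<sim> b) = \<one>"
    using local b unfolding local_mv_algebra_def by blast
  then have "b = \<one> \<or> \<sim> b = \<one>"
    using assms by (simp add: mult_idempotent neg_closed)
  then show ?thesis
    using b neg_neg[of b] by (auto simp: neg_one)
qed

lemma pow_two_eq_one_imp:
  assumes y: "y \<in> carrier A" and "pow A y 2 = \<one>"
  shows "y = \<one>"
proof -
  have "\<sim> (\<sim> y \<oplus> \<sim> y) = \<one>"
    using assms pow_two by simp
  then have "\<sim> y \<oplus> \<sim> y = \<zero>"
    using y neg_neg[of "\<sim> y \<oplus> \<sim> y"] by (simp add: neg_one neg_closed oplus_closed)
  \<comment> \<open>a sum lies above its summands, so \<open>y\<close> lies above \<open>\<sim> 0\<close>\<close>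
  moreover obtain w where "w \<in> carrier A" "\<sim> (\<sim> y) = w \<oplus> \<sim> (\<sim> y \<oplus> \<sim> y)"
    using neg_closed[OF y] neg_closed[OF y] by (rule neg_eq_oplus_neg)
  ultimately show ?thesis
    using y by (simp add: neg_neg oplus_neg_zero one_def)
qed

end

section \<open>Terms for multiples and squares\<close>

primrec mult_term :: "nat \<Rightarrow> mv_term \<Rightarrow> mv_term" where
  "mult_term 0 s = Zero"
| "mult_term (Suc k) s = Oplus s (mult_term k s)"

primrec pow_term :: "mv_term \<Rightarrow> nat \<Rightarrow> mv_term" where
  "pow_term s 0 = Neg Zero"
| "pow_term s (Suc k) = Neg (Oplus (Neg s) (Neg (pow_term s k)))"

lemma interp_mult_term: "interp A v (mult_term k s) = mult A k (interp A v s)"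
  by (induction k) simp_all

lemma interp_pow_term: "interp A v (pow_term s k) = pow A (interp A v s) k"
  by (induction k) (simp_all add: one_def odot_def)

definition square_mult_term :: "nat \<Rightarrow> mv_term" where
  "square_mult_term n = pow_term (mult_term (n + 1) (Var 0)) 2"

lemma interp_square_mult_term:
  "interp A v (square_mult_term n) = pow A (mult A (n + 1) (v 0)) 2"
  by (simp only: square_mult_term_def interp_pow_term interp_mult_term interp.simps)

definition idempotent_equations :: "mv_term \<Rightarrow> mv_equation set" where
  "idempotent_equations t = {(Oplus t t, t), (Oplus (Neg t) (Neg t), Neg t)}"

lemma (in mv_algebra) satisfies_idempotent_equations:
  assumes "\<And>x. x \<in> carrier A \<Longrightarrow>
      pow A (mult A (n + 1) x) 2 = \<zero> \<or> pow A (mult A (n + 1) x) 2 = \<one>"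
    and "e \<in> idempotent_equations (square_mult_term n)"
  shows "satisfies A e"
  unfolding satisfies_def
proof (intro allI impI)
  fix v :: "nat \<Rightarrow> 'a"
  assume "range v \<subseteq> carrier A"
  then have "interp A v (square_mult_term n) = \<zero> \<or> interp A v (square_mult_term n) = \<one>"
    unfolding interp_square_mult_term by (intro assms(1)) auto
  moreover have "e = (Oplus (square_mult_term n) (square_mult_term n), square_mult_term n) \<or>
      e = (Oplus (Neg (square_mult_term n)) (Neg (square_mult_term n)), Neg (square_mult_term n))"
    using assms(2) by (simp add: idempotent_equations_def)
  ultimately show "interp A v (fst e) = interp A v (snd e)"
    by (auto simp: oplus_zero oplus_one neg_one one_closed zero_closed simp flip: one_def)
qed

section \<open>The generating algebras\<close>

lemma mult_Gamma:
  fixes u :: "'g::lattice_ab_group_add"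
  assumes "0 \<le> x" and "0 \<le> u"
  shows "mult (Gamma u) k x = inf (\<Sum>i<k. x) u"
proof (induction k)
  case 0
  then show ?case using assms by (simp add: Gamma_def inf_absorb1)
next
  case (Suc k)
  \<comment> \<open>truncating an intermediate sum at \<open>u\<close> is harmless, because \<open>u \<le> x + u\<close>\<close>
  have "inf (x + inf (\<Sum>i<k. x) u) u = inf (x + (\<Sum>i<k. x)) u"
    using assms(1) by (simp add: add_inf_distrib_left inf_assoc inf_absorb2)
  with Suc show ?case by (simp add: Gamma_def add.commute)
qed

text \<open>
  Squaring sends \<open>y\<close> to the positive part of \<open>y + y - u\<close>, which vanishes exactly if \<open>y + y \<le> u\<close>.
\<close>

lemma Gamma_dichotomy:
  fixes u x :: "'g::lattice_ab_group_add"
  assumes x: "0 \<le> x" "x \<le> u"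
    and sum: "u \<le> (\<Sum>i<k. x) \<or> (\<Sum>i<k. x) + (\<Sum>i<k. x) \<le> u"
  shows "pow (Gamma u) (mult (Gamma u) k x) 2 = \<zero>\<^bsub>Gamma u\<^esub> \<or>
         pow (Gamma u) (mult (Gamma u) k x) 2 = \<one>\<^bsub>Gamma u\<^esub>"
proof -
  let ?s = "\<Sum>i<k. x"
  have u: "0 \<le> u" using x by (rule order_trans)
  interpret mv_algebra "Gamma u" using u by (rule mv_algebra_Gamma)
  have mult: "mult (Gamma u) k x = inf ?s u"
    using x(1) u by (rule mult_Gamma)
  have "mult (Gamma u) k x \<in> carrier (Gamma u)"
    using x by (intro mult_closed) (simp add: Gamma_def)
  note pow = pow_two[OF this, unfolded mult]
  show ?thesis
    using sum
  proof
    assume "u \<le> ?s"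
    then show ?thesis
      using u unfolding mult pow by (simp add: inf_absorb2 Gamma_def one_def inf_absorb1)
  next
    assume le: "?s + ?s \<le> u"
    have "0 \<le> ?s" using x(1) by (rule sum_nonneg)
    then have "?s \<le> ?s + ?s" by simp
    then have "?s \<le> u" using le by (rule order_trans)
    moreover have "u \<le> (u - ?s) + (u - ?s)"
      using add_left_mono[OF le, of "u - ?s - ?s"] by (simp add: algebra_simps)
    ultimately show ?thesis
      unfolding mult pow by (simp add: inf_absorb1 inf_absorb2 Gamma_def)
  qed
qed

lemma S_dichotomy:
  assumes "1 \<le> m" "m \<le> n" "x \<in> carrier (S m)"
  shows "pow (S m) (mult (S m) (n + 1) x) 2 = \<zero>\<^bsub>S m\<^esub> \<or>
         pow (S m) (mult (S m) (n + 1) x) 2 = \<one>\<^bsub>S m\<^esub>"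
  unfolding S_def
proof (rule Gamma_dichotomy)
  show "0 \<le> x" "x \<le> int m"
    using assms by (simp_all add: S_def Gamma_def)
  show "int m \<le> (\<Sum>i<n + 1. x) \<or> (\<Sum>i<n + 1. x) + (\<Sum>i<n + 1. x) \<le> int m"
  proof (cases "x = 0")
    case False
    have "int m \<le> int (n + 1) * 1" using \<open>m \<le> n\<close> by simp
    also have "\<dots> \<le> int (n + 1) * x"
      using False \<open>0 \<le> x\<close> by (intro mult_left_mono) simp_all
    finally show ?thesis by simp
  qed simp
qed

text \<open>
  For elements with leading coordinate \<open>1\<close> the factor \<open>m\<close> would not suffice: the second coordinate
  may be negative, and the \<open>m\<close>-fold sum is then below the unit. The factor \<open>n + 1\<close> makes the leading
  coordinate strictly larger than \<open>m\<close>.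
\<close>

lemma S_omega_dichotomy:
  assumes "1 \<le> m" "m \<le> n" "x \<in> carrier (S_omega m)"
  shows "pow (S_omega m) (mult (S_omega m) (n + 1) x) 2 = \<zero>\<^bsub>S_omega m\<^esub> \<or>
         pow (S_omega m) (mult (S_omega m) (n + 1) x) 2 = \<one>\<^bsub>S_omega m\<^esub>"
  unfolding S_omega_def
proof (rule Gamma_dichotomy)
  show x: "0 \<le> x" "x \<le> (int m, 0)"
    using assms by (simp_all add: S_omega_def Gamma_def)
  obtain a b where ab: "x = (a, b)" by (cases x)
  have sum: "(\<Sum>i<k. x) = (int k * a, int k * b)" for k
    by (induction k) (simp_all add: ab zero_prod_def algebra_simps)
  show "(int m, 0) \<le> (\<Sum>i<n + 1. x) \<or> (\<Sum>i<n + 1. x) + (\<Sum>i<n + 1. x) \<le> (int m, 0)"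
  proof (cases "a = 0")
    case True
    with \<open>1 \<le> m\<close> show ?thesis
      unfolding sum by (simp add: less_eq_prod_def)
  next
    case False
    with x(1) have "1 \<le> a" by (auto simp: ab less_eq_prod_def)
    have "int m < int (n + 1) * 1" using \<open>m \<le> n\<close> by simp
    also have "\<dots> \<le> int (n + 1) * a"
      using \<open>1 \<le> a\<close> by (intro mult_left_mono) simp_all
    finally show ?thesis
      unfolding sum by (simp add: less_eq_prod_def)
  qed
qed

section \<open>Locality in Komori varieties\<close>

lemma idempotent_equations_in_T_V:
  assumes "\<And>m. m \<in> I \<union> J \<Longrightarrow> 1 \<le> m \<and> m \<le> n"
  shows "idempotent_equations (square_mult_term n) \<subseteq> T_V I J"
proof
  fix e
  assume e: "e \<in> idempotent_equations (square_mult_term n)"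
  have "satisfies (S i) e" if "i \<in> I" for i
    using assms that e
    by (intro mv_algebra.satisfies_idempotent_equations[OF mv_algebra_S] S_dichotomy) auto
  moreover have "satisfies (S_omega j) e" if "j \<in> J" for j
    using assms that e
    by (intro mv_algebra.satisfies_idempotent_equations[OF mv_algebra_S_omega] S_omega_dichotomy) auto
  ultimately show "e \<in> T_V I J"
    by (simp add: T_V_def)
qed

lemma (in mv_algebra) local_imp_sigma:
  assumes local: "local_mv_algebra A"
    and sat: "\<And>e. e \<in> idempotent_equations (square_mult_term n) \<Longrightarrow> satisfies A e"
  shows "sigma n A"
  unfolding sigma_def
proof
  fix x
  assume x: "x \<in> carrier A"
  let ?y = "mult A (n + 1) x"
  let ?b = "pow A ?y 2"
  have y: "?y \<in> carrier A" using x by (rule mult_closed)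
  have range: "range (\<lambda>_. x) \<subseteq> carrier A" using x by auto
  have "?b \<oplus> ?b = ?b" "\<sim> ?b \<oplus> \<sim> ?b = \<sim> ?b"
    using sat[unfolded satisfies_def, rule_format, OF _ range]
    by (force simp: idempotent_equations_def interp_square_mult_term simp del: mult.simps)+
  then have "?b = \<zero> \<or> ?b = \<one>"
    by (intro local_idempotent_cases[OF local pow_closed[OF y]])
  then show "?b = \<zero> \<or> ?y = \<one>"
    using pow_two_eq_one_imp[OF y] by blast
qed

lemma (in mv_algebra) sigma_imp_local:
  assumes "sigma n A" and "\<zero> \<noteq> \<one>"
  shows "local_mv_algebra A"
  unfolding local_mv_algebra_def
proof (intro conjI ballI)
  show "mv_algebra A" by (rule mv_algebra_axioms)
  show "carrier A \<noteq> {\<zero>}" using one_closed assms(2) by auto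
  fix x
  assume x: "x \<in> carrier A"
  then consider "pow A (mult A (Suc n) x) 2 = \<zero>" | "mult A (Suc n) x = \<one>"
    using assms(1) unfolding sigma_def Suc_eq_plus1 by blast
  then show "\<exists>k\<ge>1. mult A k x = \<one> \<or> mult A k (\<sim> x) = \<one>"
  proof cases
    case 1
    with mult_two_neg_eq_one[OF x] show ?thesis by (intro exI[of _ 2]) simp
  next
    case 2
    then show ?thesis by (intro exI[of _ "Suc n"]) simp
  qed
qed

lemma (in mv_algebra) local_imp_zero_neq_one:
  assumes "local_mv_algebra A"
  shows "\<zero> \<noteq> \<one>"
proof
  assume "\<zero> = \<one>"
  then have "x = \<zero>" if "x \<in> carrier A" for x
    using oplus_zero[OF that] oplus_one[OF that] by metis
  then have "carrier A = {\<zero>}" using zero_closed by blast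
  then show False using assms by (simp add: local_mv_algebra_def)
qed

theorem mainTheorem10:
  fixes I J :: "nat set" and A :: "'a mv"
  assumes "finite I" and "finite J" and "\<forall>m\<in>I \<union> J. m \<ge> 1" and "I \<noteq> {} \<or> J \<noteq> {}"
    and "mv_algebra A" and "komori_variety I J A"
  shows "Loc_V1_model I J A \<longleftrightarrow> local_mv_algebra A"
proof -
  interpret mv_algebra A by fact
  have mod: "models (T_V I J) A"
    using assms(6) by (simp add: models_T_V_iff)
  have "0 \<notin> I \<union> J"
    using assms(3) by force
  then have "Lcm (I \<union> J) \<noteq> 0"
    using assms(1,2) by (simp add: Lcm_0_iff)
  then have "1 \<le> m \<and> m \<le> Lcm (I \<union> J)" if "m \<in> I \<union> J" for m
    using assms(3) that by (auto intro!: dvd_imp_le dvd_Lcm)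
  then have "idempotent_equations (square_mult_term (Lcm (I \<union> J))) \<subseteq> T_V I J"
    by (rule idempotent_equations_in_T_V)
  then have "sigma (Lcm (I \<union> J)) A" if "local_mv_algebra A"
    using mod that by (intro local_imp_sigma) (auto simp: models_def)
  then show ?thesis
    using mod sigma_imp_local local_imp_zero_neq_one unfolding Loc_V1_model_def by blast
qed

end
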